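(* Let $b_n$, $n\ge0$, be the Bernoulli numbers of the second kind, defined by $\frac{x}{\ln(1+x)}=\sum_{n=0}^\infty b_n x^n$ near $x=0$. Then the sequence $\{i!\,b_{i+1}\}_{i=0}^\infty$ is logarithmically convex, that is, for every integer $i\ge0$, $$(i!\,b_{i+1})\,[(i+2)!\,b_{i+3}]\ge [(i+1)!\,b_{i+2}]^2.$$
   Context: The function $x/\ln(1+x)$ is extended to $x=0$ by the value $1$; the $b_n$ are its Taylor coefficients at $0$. A real sequence $\{c_i\}_{i\ge0}$ (here not required to be positive) is called logarithmically convex if $c_i c_{i+2}\ge c_{i+1}^2$ for all $i\ge0$. *)

theory Defs
  imports "HOL-Analysis.Analysis"
begin

definition bernoulli2_gf :: "real \<Rightarrow> real" where
  "bernoulli2_gf x = (if x = 0 then 1 else x / ln (1 + x))"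

text \<open>
  The Bernoulli numbers of the second kind (Gregory coefficients) as Taylor coefficients at 0.
  Lemmas \<open>bernoulli2_sums\<close> and \<open>bernoulli2_unique\<close> below show that they are
  the unique coefficients of a power series representing the generating function near 0.
\<close>

definition bernoulli2 :: "nat \<Rightarrow> real" where
  "bernoulli2 n = (deriv ^^ n) bernoulli2_gf 0 / fact n"

text \<open>Positivity of the sequence is deliberately not required.\<close>

definition log_convex_seq :: "(nat \<Rightarrow> real) \<Rightarrow> bool" where
  "log_convex_seq c \<longleftrightarrow> (\<forall>i. c i * c (i + 2) \<ge> (c (i + 1))\<^sup>2)"

lemma has_fps_expansion_ln_1_plus: "(\<lambda>x::real. ln (1 + x)) has_fps_expansion fps_ln 1"
proof (rule has_fps_expansionI)
  have "eventually (\<lambda>u::real. u \<in> ball 0 1) (nhds 0)"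
    by (intro eventually_nhds_in_open) auto
  thus "eventually (\<lambda>u::real. (\<lambda>n. fps_nth (fps_ln 1) n * u ^ n) sums ln (1 + u)) (nhds 0)"
  proof eventually_elim
    case (elim u)
    hence u: "\<bar>u\<bar> < 1" by simp
    have "summable (\<lambda>n. fps_nth (fps_ln 1) n * u ^ n)"
      using u by (intro summable_fps) simp
    hence s: "summable (\<lambda>n. fps_nth (fps_ln 1) (Suc n) * u ^ Suc n)"
      by (subst summable_Suc_iff)
    have "ln (1 + u) = (\<Sum>n. (-1) ^ n * (1 / real (n + 1)) * u ^ Suc n)"
      using ln_series[of "1 + u"] u by simp
    also have "\<dots> = (\<Sum>n. fps_nth (fps_ln 1) (Suc n) * u ^ Suc n)"
      by (simp add: fps_ln_nth)
    finally have "(\<lambda>n. fps_nth (fps_ln 1) (Suc n) * u ^ Suc n) sums ln (1 + u)"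
      using s by (simp add: sums_iff)
    thus ?case by (subst (asm) sums_Suc_iff) simp
  qed
qed

lemma fps_nth_conv_higher_deriv_real:
  fixes f :: "real \<Rightarrow> real"
  assumes "f has_fps_expansion F"
  shows   "fps_nth F n = (deriv ^^ n) f 0 / fact n"
  using assms
proof (induction n arbitrary: f F)
  case 0
  thus ?case by (auto simp: has_fps_expansion_def eval_fps_at_0 dest: eventually_nhds_x_imp_x)
next
  case (Suc n)
  have "fps_nth (fps_deriv F) n = (deriv ^^ n) (deriv f) 0 / fact n"
    by (intro Suc.IH has_fps_expansion_deriv Suc.prems)
  hence "real (Suc n) * fps_nth F (Suc n) = (deriv ^^ Suc n) f 0 / fact n"
    by (simp add: funpow_Suc_right del: funpow.simps of_nat_Suc)
  thus ?case by (simp add: eq_divide_eq mult_ac del: funpow.simps of_nat_Suc)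
qed

lemma bernoulli2_gf_has_fps_expansion: "bernoulli2_gf has_fps_expansion Abs_fps bernoulli2"
proof -
  have nz: "fps_nth (fps_ln (1::real)) 1 \<noteq> 0"
    by (simp add: fps_ln_nth)
  hence sub: "subdegree (fps_ln (1::real)) = 1"
    by (intro subdegreeI) (auto simp: fps_ln_nth)
  have "(\<lambda>x::real. if x = 0 then 1 else x / ln (1 + x)) has_fps_expansion fps_X / fps_ln 1"
    by (rule has_fps_expansion_divide[OF has_fps_expansion_fps_X has_fps_expansion_ln_1_plus])
       (use sub nz in \<open>auto simp: fps_ln_nth\<close>)
  hence *: "bernoulli2_gf has_fps_expansion fps_X / fps_ln 1"
    by (simp add: bernoulli2_gf_def [abs_def])
  have "fps_X / fps_ln 1 = Abs_fps bernoulli2"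
    by (simp add: fps_eq_iff fps_nth_conv_higher_deriv_real[OF *] bernoulli2_def)
  with * show ?thesis by simp
qed

lemma bernoulli2_sums:
  "eventually (\<lambda>x. (\<lambda>n. bernoulli2 n * x ^ n) sums bernoulli2_gf x) (nhds 0)"
proof -
  let ?F = "Abs_fps bernoulli2"
  have F: "fps_conv_radius ?F > 0" "eventually (\<lambda>x. eval_fps ?F x = bernoulli2_gf x) (nhds 0)"
    using bernoulli2_gf_has_fps_expansion by (auto simp: has_fps_expansion_def)
  have "eventually (\<lambda>x. x \<in> eball 0 (fps_conv_radius ?F)) (nhds 0)"
    using F(1) by (intro eventually_nhds_in_open) (auto simp: zero_ereal_def)
  with F(2) show ?thesis
  proof eventually_elim
    case (elim x)
    thus ?case using sums_eval_fps[of x ?F] by simp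
  qed
qed

lemma bernoulli2_unique:
  assumes "eventually (\<lambda>x. (\<lambda>n. b n * x ^ n) sums bernoulli2_gf x) (nhds 0)"
  shows   "b = bernoulli2"
proof
  fix n
  have "bernoulli2_gf has_fps_expansion Abs_fps b"
    using assms by (intro has_fps_expansionI) simp
  from fps_nth_conv_higher_deriv_real[OF this, of n] show "b n = bernoulli2 n"
    by (simp add: bernoulli2_def)
qed

end

theory Submission
  imports Defs
begin

text \<open>
  Integrating the binomial series of \<open>(1 + u) powr s\<close> over \<open>s \<in> {0..1}\<close> gives
  \<open>u / ln (1 + u)\<close>, so \<open>b\<^sub>n\<close> is the integral of \<open>s gchoose n\<close>. Hence, up to the sign
  \<open>(-1) ^ i\<close>, \<open>i! b\<^bsub>i+1\<^esub>\<close> is the integral of \<open>s (1 - s) \<dots> (i - s) / (i + 1)\<close>. For fixed \<open>s\<close> this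
  is nonnegative and logarithmically convex in \<open>i\<close>, since its consecutive quotients
  \<open>(i + 1) (i + 1 - s) / (i + 2)\<close> increase with \<open>i\<close>; the Cauchy--Schwarz inequality transfers
  logarithmic convexity to the integral.
\<close>

text \<open>Discriminant criterion: the right-hand side is linear in \<open>a\<close>,
  \<open>b\<close> and \<open>c\<close> for each fixed \<open>l\<close>, a form that survives
  integration.\<close>

lemma square_le_mult_iff_quadratic:
  fixes a b c :: real
  assumes "a \<ge> 0" "c \<ge> 0"
  shows "b\<^sup>2 \<le> a * c \<longleftrightarrow> (\<forall>l. 2 * l * b \<le> l\<^sup>2 * a + c)"
proof (cases "a = 0")
  case True
  show ?thesis
  proof (cases "b = 0")
    case False
    \<comment> \<open>With \<open>a = 0\<close> the quadratic degenerates to a linear inequality;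
      this \<open>l\<close> makes its left side \<open>c + 1\<close>.\<close>
    hence "\<not> 2 * ((c + 1) / (2 * b)) * b \<le> c"
      by simp
    hence "\<not> (\<forall>l. 2 * l * b \<le> l\<^sup>2 * a + c)"
      unfolding True by (metis mult_zero_right add_0)
    with True False show ?thesis by simp
  qed (use True assms in auto)
next
  case False
  hence a: "a > 0" using assms by simp
  have "a * (l\<^sup>2 * a + c - 2 * l * b) = (l * a - b)\<^sup>2 + (a * c - b\<^sup>2)" for l
    by (simp add: power2_eq_square algebra_simps)
  hence *: "2 * l * b \<le> l\<^sup>2 * a + c \<longleftrightarrow> 0 \<le> (l * a - b)\<^sup>2 + (a * c - b\<^sup>2)" for l
    using a by (metis diff_ge_0_iff_ge zero_le_mult_iff linorder_not_less order_less_imp_le)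
  show ?thesis
  proof
    assume "b\<^sup>2 \<le> a * c"
    thus "\<forall>l. 2 * l * b \<le> l\<^sup>2 * a + c" by (simp add: *)
  next
    assume "\<forall>l. 2 * l * b \<le> l\<^sup>2 * a + c"
    \<comment> \<open>The vertex \<open>l = b / a\<close> makes the completed square vanish.\<close>
    hence "0 \<le> (b / a * a - b)\<^sup>2 + (a * c - b\<^sup>2)"
      unfolding * by blast
    with a show "b\<^sup>2 \<le> a * c" by simp
  qed
qed

text \<open>Cauchy--Schwarz via the discriminant: the criterion is applied pointwise, integrated for
  each fixed \<open>l\<close>, and then applied backwards to the three integrals.\<close>

lemma integral_square_le_mult:
  fixes f g h :: "real \<Rightarrow> real"
  assumes int: "f integrable_on S" "g integrable_on S" "h integrable_on S"
    and nonneg: "\<And>x. x \<in> S \<Longrightarrow> f x \<ge> 0" "\<And>x. x \<in> S \<Longrightarrow> h x \<ge> 0"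
    and le: "\<And>x. x \<in> S \<Longrightarrow> (g x)\<^sup>2 \<le> f x * h x"
  shows "(integral S g)\<^sup>2 \<le> integral S f * integral S h"
proof -
  have "2 * l * integral S g \<le> l\<^sup>2 * integral S f + integral S h" for l
  proof -
    have "integral S (\<lambda>x. 2 * l * g x) \<le> integral S (\<lambda>x. l\<^sup>2 * f x + h x)"
    proof (rule integral_le)
      show "(\<lambda>x. 2 * l * g x) integrable_on S" "(\<lambda>x. l\<^sup>2 * f x + h x) integrable_on S"
        using int by (auto intro!: integrable_add integrable_on_mult_right)
      show "2 * l * g x \<le> l\<^sup>2 * f x + h x" if "x \<in> S" for x
        using square_le_mult_iff_quadratic[of "f x" "h x" "g x"] nonneg le that by blast
    qed
    also have "\<dots> = l\<^sup>2 * integral S f + integral S h"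
      using int by (simp add: integral_add integrable_on_mult_right)
    finally show ?thesis by simp
  qed
  moreover have "integral S f \<ge> 0" "integral S h \<ge> 0"
    using int nonneg by (auto intro: integral_nonneg)
  ultimately show ?thesis
    by (simp add: square_le_mult_iff_quadratic)
qed

lemma gbinomial_Suc_rec:
  fixes a :: "'a :: field_char_0"
  shows "a gchoose Suc n = (a - of_nat n) / of_nat (Suc n) * (a gchoose n)"
  using gbinomial_mult_1[of a n] by (simp add: field_simps del: of_nat_Suc)

text \<open>Passing from \<open>n\<close> to \<open>Suc n\<close> multiplies by
  \<open>(s - n) / (n + 1)\<close>, of modulus at most 1. The bound is uniform in \<open>s\<close>,
  so a geometric series dominates the binomial series.\<close>

lemma abs_gbinomial_le_1:
  fixes s :: real
  assumes "0 \<le> s" "s \<le> 1"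
  shows "\<bar>s gchoose n\<bar> \<le> 1"
proof (induction n)
  case (Suc n)
  have "\<bar>(s - real n) / real (Suc n)\<bar> \<le> 1"
    using assms by simp
  with Suc show ?case
    unfolding gbinomial_Suc_rec abs_mult by (intro mult_le_one) auto
qed simp

lemma continuous_on_gbinomial [continuous_intros]:
  "continuous_on S (\<lambda>s::real. s gchoose n)"
  unfolding gbinomial_prod_rev by (intro continuous_intros) auto

lemma integral_powr_exponent:
  fixes u :: real
  assumes "\<bar>u\<bar> < 1"
  shows "((\<lambda>s. (1 + u) powr s) has_integral bernoulli2_gf u) {0..1}"
proof (cases "u = 0")
  case True
  thus ?thesis
    using has_integral_const_real[of "1::real" 0 1] by (simp add: bernoulli2_gf_def)
next
  case False
  have u: "1 + u > 0" "ln (1 + u) \<noteq> 0"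
    using assms False by auto
  have "((\<lambda>s. exp (s * ln (1 + u))) has_integral
          (exp (1 * ln (1 + u)) / ln (1 + u) - exp (0 * ln (1 + u)) / ln (1 + u))) {0..1}"
    by (rule fundamental_theorem_of_calculus)
       (use u in \<open>auto intro!: derivative_eq_intros
         simp flip: has_real_derivative_iff_has_vector_derivative\<close>)
  thus ?thesis
    using u False by (simp add: bernoulli2_gf_def powr_def flip: diff_divide_distrib)
qed

text \<open>Termwise integration over \<open>s\<close> of the binomial series, justified by uniform
  convergence on \<open>{0..1}\<close>.\<close>

lemma bernoulli2_gf_sums_integral:
  fixes u :: real
  assumes u: "\<bar>u\<bar> < 1"
  shows "(\<lambda>n. integral {0..1} (\<lambda>s. s gchoose n) * u ^ n) sums bernoulli2_gf u"
proof -
  let ?P = "\<lambda>n s. \<Sum>k<n. (s gchoose k) * u ^ k"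
  have "uniform_limit {0..1} ?P (\<lambda>s. \<Sum>k. (s gchoose k) * u ^ k) sequentially"
  proof (rule Weierstrass_m_test)
    show "summable (\<lambda>n. \<bar>u\<bar> ^ n)" using u by (simp add: summable_geometric)
    show "norm ((s gchoose n) * u ^ n) \<le> \<bar>u\<bar> ^ n" if "s \<in> {0..1}" for n s
      using abs_gbinomial_le_1[of s n] that
      by (auto simp: abs_mult power_abs intro: mult_left_le_one_le)
  qed
  moreover have "(\<Sum>k. (s gchoose k) * u ^ k) = (1 + u) powr s" for s
    using gen_binomial_real[OF u] by (rule sums_unique[symmetric])
  ultimately have "uniform_limit {0..1} ?P (\<lambda>s. (1 + u) powr s) sequentially"
    by simp
  then obtain I J where I: "\<And>n. (?P n has_integral I n) {0..1}"
    and J: "((\<lambda>s. (1 + u) powr s) has_integral J) {0..1}" and lim: "I \<longlonglongrightarrow> J"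
    by (rule uniform_limit_integral) (auto intro!: continuous_intros)
  have "I n = (\<Sum>k<n. integral {0..1} (\<lambda>s. s gchoose k) * u ^ k)" for n
  proof (rule has_integral_unique[OF I])
    show "(?P n has_integral (\<Sum>k<n. integral {0..1} (\<lambda>s. s gchoose k) * u ^ k)) {0..1}"
      by (intro has_integral_sum has_integral_mult_left integrable_integral
            integrable_continuous_real continuous_intros) auto
  qed
  moreover have "J = bernoulli2_gf u"
    using has_integral_unique[OF J integral_powr_exponent[OF u]] .
  moreover note lim
  ultimately show ?thesis
    unfolding sums_def by presburger
qed

lemma bernoulli2_eq_integral: "bernoulli2 n = integral {0..1} (\<lambda>s. s gchoose n)"
proof -
  have "eventually (\<lambda>u::real. u \<in> ball 0 1) (nhds 0)"
    by (intro eventually_nhds_in_open) auto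
  hence "eventually (\<lambda>u. (\<lambda>n. integral {0..1} (\<lambda>s. s gchoose n) * u ^ n) sums bernoulli2_gf u)
           (nhds 0)"
    by eventually_elim (simp add: bernoulli2_gf_sums_integral)
  from bernoulli2_unique[OF this] show ?thesis
    by metis
qed

text \<open>This is \<open>s (1 - s) ... (i - s) / (i + 1)\<close>; the factor
  \<open>(-1) ^ i\<close> makes it nonnegative on \<open>{0..1}\<close>.\<close>

definition gregory_integrand :: "nat \<Rightarrow> real \<Rightarrow> real" where
  "gregory_integrand i s = (-1) ^ i * fact i * (s gchoose Suc i)"

lemma gregory_integrand_Suc:
  "gregory_integrand (Suc i) s =
     real (Suc i) * (real (Suc i) - s) / real (Suc (Suc i)) * gregory_integrand i s"
proof -
  have "gregory_integrand (Suc i) s = (-1) ^ Suc i * fact (Suc i) *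
          ((s - real (Suc i)) / real (Suc (Suc i)) * (s gchoose Suc i))"
    unfolding gregory_integrand_def gbinomial_Suc_rec[of s "Suc i"] ..
  thus ?thesis
    unfolding gregory_integrand_def fact_Suc power_Suc
    by (simp add: field_simps del: of_nat_Suc)
qed

lemma gregory_integrand_nonneg:
  assumes "0 \<le> s" "s \<le> 1"
  shows "gregory_integrand i s \<ge> 0"
proof (induction i)
  case 0
  thus ?case using assms by (simp add: gregory_integrand_def)
next
  case (Suc i)
  thus ?case
    unfolding gregory_integrand_Suc using assms
    by (intro mult_nonneg_nonneg divide_nonneg_nonneg) auto
qed

lemma gregory_integrand_log_convex:
  assumes "0 \<le> s" "s \<le> 1"
  shows "(gregory_integrand (Suc i) s)\<^sup>2 \<le> gregory_integrand i s * gregory_integrand (Suc (Suc i)) s"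
proof -
  define r where "r k = real (Suc k) * (real (Suc k) - s) / real (Suc (Suc k))" for k
  have rec: "gregory_integrand (Suc k) s = r k * gregory_integrand k s" for k
    by (simp add: gregory_integrand_Suc r_def)
  have r: "0 \<le> r i"
    using assms by (simp add: r_def)
  have "real (Suc i) / real (Suc (Suc i)) \<le> real (Suc (Suc i)) / real (Suc (Suc (Suc i)))"
    by (simp add: field_simps)
  \<comment> \<open>Both nonnegative factors of the quotient \<open>r k\<close> grow with
    \<open>k\<close>.\<close>
  hence "real (Suc i) / real (Suc (Suc i)) * (real (Suc i) - s)
           \<le> real (Suc (Suc i)) / real (Suc (Suc (Suc i))) * (real (Suc (Suc i)) - s)"
    using assms by (intro mult_mono) auto
  hence "r i \<le> r (Suc i)"
    by (simp add: r_def)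
  hence "(r i * r i) * (gregory_integrand i s)\<^sup>2 \<le> (r i * r (Suc i)) * (gregory_integrand i s)\<^sup>2"
    using r by (intro mult_right_mono mult_left_mono) auto
  thus ?thesis
    by (simp add: rec power2_eq_square mult_ac)
qed

lemma gregory_integrand_integrable: "gregory_integrand i integrable_on {0..1}"
  unfolding gregory_integrand_def [abs_def]
  by (intro integrable_continuous_real continuous_intros)

lemma fact_mult_bernoulli2_Suc:
  "fact i * bernoulli2 (Suc i) = (-1) ^ i * integral {0..1} (gregory_integrand i)"
  by (simp add: bernoulli2_eq_integral gregory_integrand_def [abs_def] flip: mult.assoc power_mult_distrib)

theorem theorem5p4:
  shows "log_convex_seq (\<lambda>i. fact i * bernoulli2 (i + 1))"
  unfolding log_convex_seq_def
proof
  fix i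
  define I where "I k = integral {0..1} (gregory_integrand k)" for k
  have c: "fact k * bernoulli2 (k + 1) = (-1) ^ k * I k" for k
    by (simp add: fact_mult_bernoulli2_Suc I_def)
  have "(I (i + 1))\<^sup>2 \<le> I i * I (i + 2)"
    unfolding I_def using gregory_integrand_log_convex[of _ i]
    by (intro integral_square_le_mult gregory_integrand_integrable)
       (auto simp: gregory_integrand_nonneg)
  \<comment> \<open>The signs occur with even total exponent on each side, so they
    disappear.\<close>
  moreover have "((-1::real) ^ i)\<^sup>2 = 1"
    by (simp add: power2_eq_square flip: power_mult_distrib)
  ultimately show "(fact (i + 1) * bernoulli2 (i + 1 + 1))\<^sup>2
          \<le> fact i * bernoulli2 (i + 1) * (fact (i + 2) * bernoulli2 (i + 2 + 1))"
    unfolding c by (simp add: power_mult_distrib mult_ac flip: power_add mult.assoc)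
qed

end
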